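(* Let $F$ be a formally real field and let $A=M_n(F)$ be a split algebra of even degree $n=2m$, equipped with a symplectic involution $\sigma$. Then the PS Conjecture holds for $(A,\sigma)$; that is, every totally $\sigma$-positive element of $A$ is a sum of hermitian squares in $(A,\sigma)$.
   Context: An involution $\sigma$ on $M_n(F)$ (an $F$-linear anti-automorphism with $\sigma^2=\mathrm{id}$) is symplectic if it is adjoint to a nonsingular alternating form. Put $\mathrm{Sym}(A,\sigma)=\{a\in A:\sigma(a)=a\}$ and let $\mathrm{Trd}:A\to F$ be the reduced trace (the matrix trace). An ordering $\leq_P$ of the field $F$ is a $\sigma$-ordering if $0\leq_P\mathrm{Trd}(\sigma(x)x)$ for all $x\in A$. An element $a\in\mathrm{Sym}(A,\sigma)$ is $\sigma$-positive with respect to a $\sigma$-ordering $\leq_P$ if $0\leq_P\mathrm{Trd}(\sigma(x)ax)$ for all $x\in A$; it is totally $\sigma$-positive if it is $\sigma$-positive with respect to all $\sigma$-orderings of $F$ (a vacuous condition if there are none). Hermitian squares in $(A,\sigma)$ are elements $\sigma(x)x$ with $x\in A$; sums are finite. "The PS Conjecture holds for $(A,\sigma)$" means: every totally $\sigma$-positive element of $A$ is a sum of hermitian squares in $(A,\sigma)$. *)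

theory Defs
  imports "HOL-Analysis.Analysis"
begin

definition formally_real :: "'a::field itself \<Rightarrow> bool" where
  "formally_real _ \<longleftrightarrow> \<not> (\<exists>xs :: 'a list. (\<Sum>x\<leftarrow>xs. x\<^sup>2) = - 1)"

definition field_ordering :: "('a::field \<Rightarrow> 'a \<Rightarrow> bool) \<Rightarrow> bool" where
  "field_ordering le \<longleftrightarrow>
     linear_order {(a, b). le a b} \<and>
     (\<forall>a b c. le a b \<longrightarrow> le (a + c) (b + c)) \<and>
     (\<forall>a b. le 0 a \<longrightarrow> le 0 b \<longrightarrow> le 0 (a * b))"

text \<open>
  The library's \<^const>\<open>bilinear\<close> is restricted to real vector spaces, and on \<open>'a^'n^'n\<close>
  its \<open>*s\<close> multiplies by vectors, not by scalars. Hence linearity over \<open>'a\<close> is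
  expressed by \<^const>\<open>Vector_Spaces.linear\<close> with explicit scalings.
\<close>

abbreviation scale_matrix :: "'a::field \<Rightarrow> 'a^'n^'n \<Rightarrow> 'a^'n^'n" where
  "scale_matrix c \<equiv> map_matrix ((*) c)"

lemma vector_space_scale_matrix:
  "vector_space (scale_matrix :: 'a::field \<Rightarrow> 'a^'n^'n \<Rightarrow> 'a^'n^'n)"
  by unfold_locales (simp_all add: vec_eq_iff algebra_simps)

definition involution :: "('a::field^'n^'n \<Rightarrow> 'a^'n^'n) \<Rightarrow> bool" where
  "involution \<sigma> \<longleftrightarrow>
     Vector_Spaces.linear scale_matrix scale_matrix \<sigma> \<and>
     (\<forall>x y. \<sigma> (x ** y) = \<sigma> y ** \<sigma> x) \<and>
     (\<forall>x. \<sigma> (\<sigma> x) = x)"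

definition bilinear_form :: "('a::field^'n \<Rightarrow> 'a^'n \<Rightarrow> 'a) \<Rightarrow> bool" where
  "bilinear_form b \<longleftrightarrow>
     (\<forall>w. Vector_Spaces.linear (*s) (*) (\<lambda>v. b v w)) \<and>
     (\<forall>v. Vector_Spaces.linear (*s) (*) (\<lambda>w. b v w))"

definition alternating_form :: "('a::field^'n \<Rightarrow> 'a^'n \<Rightarrow> 'a) \<Rightarrow> bool" where
  "alternating_form b \<longleftrightarrow> bilinear_form b \<and> (\<forall>v. b v v = 0)"

definition nonsingular_form :: "('a::field^'n \<Rightarrow> 'a^'n \<Rightarrow> 'a) \<Rightarrow> bool" where
  "nonsingular_form b \<longleftrightarrow> (\<forall>v. (\<forall>w. b v w = 0) \<longrightarrow> v = 0)"

definition adjoint_to ::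
  "('a::field^'n^'n \<Rightarrow> 'a^'n^'n) \<Rightarrow> ('a^'n \<Rightarrow> 'a^'n \<Rightarrow> 'a) \<Rightarrow> bool" where
  "adjoint_to \<sigma> b \<longleftrightarrow> (\<forall>x v w. b v (x *v w) = b (\<sigma> x *v v) w)"

definition symplectic :: "('a::field^'n^'n \<Rightarrow> 'a^'n^'n) \<Rightarrow> bool" where
  "symplectic \<sigma> \<longleftrightarrow> involution \<sigma> \<and>
     (\<exists>b. alternating_form b \<and> nonsingular_form b \<and> adjoint_to \<sigma> b)"

definition Sym :: "('a::field^'n^'n \<Rightarrow> 'a^'n^'n) \<Rightarrow> ('a^'n^'n) set" where
  "Sym \<sigma> = {a. \<sigma> a = a}"

definition sigma_ordering ::
  "('a::field^'n^'n \<Rightarrow> 'a^'n^'n) \<Rightarrow> ('a \<Rightarrow> 'a \<Rightarrow> bool) \<Rightarrow> bool" where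
  "sigma_ordering \<sigma> le \<longleftrightarrow>
     field_ordering le \<and> (\<forall>x. le 0 (trace (\<sigma> x ** x)))"

definition sigma_positive ::
  "('a::field^'n^'n \<Rightarrow> 'a^'n^'n) \<Rightarrow> ('a \<Rightarrow> 'a \<Rightarrow> bool) \<Rightarrow> 'a^'n^'n \<Rightarrow> bool" where
  "sigma_positive \<sigma> le a \<longleftrightarrow>
     a \<in> Sym \<sigma> \<and> (\<forall>x. le 0 (trace (\<sigma> x ** a ** x)))"

text \<open>
  Membership in \<open>Sym \<sigma>\<close> is repeated here because the quantification over orderings may be
  vacuous, in which case every symmetric element (but no other) is totally positive.
\<close>

definition totally_sigma_positive ::
  "('a::field^'n^'n \<Rightarrow> 'a^'n^'n) \<Rightarrow> 'a^'n^'n \<Rightarrow> bool" where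
  "totally_sigma_positive \<sigma> a \<longleftrightarrow>
     a \<in> Sym \<sigma> \<and> (\<forall>le. sigma_ordering \<sigma> le \<longrightarrow> sigma_positive \<sigma> le a)"

definition hermitian_squares :: "('a::field^'n^'n \<Rightarrow> 'a^'n^'n) \<Rightarrow> ('a^'n^'n) set" where
  "hermitian_squares \<sigma> = range (\<lambda>x. \<sigma> x ** x)"

definition sum_of_hermitian_squares ::
  "('a::field^'n^'n \<Rightarrow> 'a^'n^'n) \<Rightarrow> 'a^'n^'n \<Rightarrow> bool" where
  "sum_of_hermitian_squares \<sigma> a \<longleftrightarrow>
     (\<exists>hs. set hs \<subseteq> hermitian_squares \<sigma> \<and> a = sum_list hs)"

definition PS_Conjecture :: "('a::field^'n^'n \<Rightarrow> 'a^'n^'n) \<Rightarrow> bool" where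
  "PS_Conjecture \<sigma> \<longleftrightarrow>
     (\<forall>a. totally_sigma_positive \<sigma> a \<longrightarrow> sum_of_hermitian_squares \<sigma> a)"

end

theory Submission
  imports Defs
begin

text \<open>
  Let \<open>b\<close> be an alternating form to which \<open>\<sigma>\<close> is adjoint. For \<open>b p q = 1\<close>, the map
  \<open>x v = c v\<^sub>i p + v\<^sub>j q\<close> satisfies \<open>b (\<sigma> x x v) w = b (x v) (x w) = c (v\<^sub>i w\<^sub>j - v\<^sub>j w\<^sub>i)\<close>, so
  every elementary alternating form comes from a single hermitian square. If \<open>\<sigma> a = a\<close>, then
  \<open>b (a v) w\<close> is skew-symmetric, hence a sum of elementary alternating forms because
  2 is invertible. Therefore every symmetric element is a sum of hermitian squares,
  whatever the orderings of the field are.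
\<close>

text \<open>In characteristic 2, \<open>- 1 = 1\<close> is itself a square, which formal reality
  forbids.\<close>

lemma formally_real_two_neq_0:
  assumes "formally_real TYPE('a::field)"
  shows "(2::'a) \<noteq> 0"
proof
  assume "(2::'a) = 0"
  then have "(1::'a) = - 1"
    by (metis add_eq_0_iff one_add_one)
  then have "(\<Sum>x\<leftarrow>[1::'a]. x\<^sup>2) = - 1"
    by simp
  with assms show False
    unfolding formally_real_def by blast
qed

context
  fixes b :: "'a::field^'n \<Rightarrow> 'a^'n \<Rightarrow> 'a"
  assumes bilinear: "bilinear_form b"
begin

text \<open>Seeing each argument as a \<open>module_hom\<close> makes the rules for sums, scalings
  and differences available.\<close>

lemma bilinear_form_hom_left: "module_hom (*s) (*) (\<lambda>v. b v w)"
  using bilinear unfolding bilinear_form_def by (simp add: linear_iff_module_hom)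

lemma bilinear_form_hom_right: "module_hom (*s) (*) (\<lambda>w. b v w)"
  using bilinear unfolding bilinear_form_def by (simp add: linear_iff_module_hom)

lemmas bilinear_form_simps =
  module_hom.add[OF bilinear_form_hom_left] module_hom.add[OF bilinear_form_hom_right]
  module_hom.scale[OF bilinear_form_hom_left] module_hom.scale[OF bilinear_form_hom_right]

lemmas bilinear_form_sum_left = module_hom.sum[OF bilinear_form_hom_left]

lemmas bilinear_form_diff_left = module_hom.diff[OF bilinear_form_hom_left]

lemma bilinear_form_expansion:
  "b v w = (\<Sum>i\<in>UNIV. \<Sum>j\<in>UNIV. v$i * w$j * b (axis i 1) (axis j 1))"
proof -
  have "b v w = b (\<Sum>i\<in>UNIV. v$i *s axis i 1) (\<Sum>j\<in>UNIV. w$j *s axis j 1)"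
    by (simp add: basis_expansion)
  also have "\<dots> = (\<Sum>i\<in>UNIV. \<Sum>j\<in>UNIV. v$i * w$j * b (axis i 1) (axis j 1))"
    by (simp add: bilinear_form_sum_left module_hom.sum[OF bilinear_form_hom_right]
        bilinear_form_simps sum_distrib_left mult_ac) (rule sum.swap)
  finally show ?thesis .
qed

text \<open>This allows \<open>bilinear_form_expansion\<close> to be applied to the form that
  \<open>a\<close> induces.\<close>

lemma bilinear_form_comp_matrix: "bilinear_form (\<lambda>v w. b (a *v v) w)"
proof -
  have "module_hom (*s) (*s) ((*v) a)"
    using matrix_vector_mul_linear_gen[of a] by (simp add: linear_iff_module_hom)
  from module_hom_compose[OF this bilinear_form_hom_left] show ?thesis
    using bilinear unfolding bilinear_form_def
    by (simp add: linear_iff_module_hom o_def)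
qed

end

text \<open>Polarization: expand \<open>b (v + w) (v + w) = 0\<close>.\<close>

lemma alternating_form_skew:
  assumes "alternating_form b"
  shows "b v w = - b w v"
proof -
  have bil: "bilinear_form b" and alt: "\<And>v. b v v = 0"
    using assms unfolding alternating_form_def by auto
  have "b (v + w) (v + w) = b v v + b v w + (b w v + b w w)"
    by (simp only: bilinear_form_simps[OF bil] ac_simps)
  then show ?thesis
    by (simp add: alt eq_neg_iff_add_eq_0)
qed

text \<open>A distinct enumeration of \<open>I\<close> turns the indexed sum into a list sum; since
  lists keep repeated values, \<open>f\<close> may fail to be injective.\<close>

lemma sum_of_hermitian_squares_sum:
  assumes "finite I" "\<And>i. i \<in> I \<Longrightarrow> f i \<in> hermitian_squares \<sigma>"
  shows "sum_of_hermitian_squares \<sigma> (sum f I)"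
proof -
  obtain xs where xs: "set xs = I" "distinct xs"
    using assms(1) finite_distinct_list by blast
  have "sum f I = sum_list (map f xs)"
    using xs sum.distinct_set_conv_list[of xs f] by simp
  moreover have "set (map f xs) \<subseteq> hermitian_squares \<sigma>"
    using xs assms(2) by auto
  ultimately show ?thesis
    unfolding sum_of_hermitian_squares_def by blast
qed

lemma nonsingular_form_hyperbolic_pair:
  fixes b :: "'a::field^'n \<Rightarrow> 'a^'n \<Rightarrow> 'a"
  assumes "bilinear_form b" "nonsingular_form b"
  obtains p q where "b p q = 1"
proof -
  \<comment> \<open>Here \<open>1\<close> is the all-ones vector, nonzero because index types are
    nonempty.\<close>
  have "(1::'a^'n) \<noteq> 0"
    by (simp add: vec_eq_iff)
  then obtain w where "b 1 w \<noteq> 0"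
    using assms(2) unfolding nonsingular_form_def by blast
  then have "b 1 (inverse (b 1 w) *s w) = 1"
    by (simp add: bilinear_form_simps[OF assms(1)])
  then show ?thesis
    using that by blast
qed

lemma hermitian_square_elementary_alternating:
  fixes b :: "'a::field^'n \<Rightarrow> 'a^'n \<Rightarrow> 'a"
  assumes alt: "alternating_form b" and ns: "nonsingular_form b" and adj: "adjoint_to \<sigma> b"
  obtains h where "h \<in> hermitian_squares \<sigma>"
    "\<And>v w. b (h *v v) w = c * (v$i * w$j - v$j * w$i)"
proof -
  have bil: "bilinear_form b" and diag: "\<And>v. b v v = 0"
    using alt unfolding alternating_form_def by auto
  obtain p q where pq: "b p q = 1"
    using nonsingular_form_hyperbolic_pair[OF bil ns] .
  then have qp: "b q p = - 1"
    using alternating_form_skew[OF alt, of q p] by simp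
  \<comment> \<open>Column \<open>i\<close> receives \<open>c\<close> times \<open>p\<close> and
    column \<open>j\<close> receives \<open>q\<close>. Adding two conditionals also covers
    \<open>i = j\<close>, where the resulting form is zero. Scaling only \<open>p\<close> avoids any
    square root of \<open>c\<close>.\<close>
  define x :: "'a^'n^'n" where
    "x = (\<chi> r s. (if s = i then c * p$r else 0) + (if s = j then q$r else 0))"
  have x: "x *v v = (c * v$i) *s p + v$j *s q" for v
    by (simp add: x_def matrix_vector_mult_def vec_eq_iff distrib_right sum.distrib
        if_distrib[of "\<lambda>t. t * _"] cong: if_cong)
  have "b ((\<sigma> x ** x) *v v) w = c * (v$i * w$j - v$j * w$i)" for v w
  proof -
    have "b ((\<sigma> x ** x) *v v) w = b (x *v v) (x *v w)"
      using adj unfolding adjoint_to_def by (simp add: matrix_vector_mul_assoc[symmetric])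
    then show ?thesis
      by (simp add: x bilinear_form_simps[OF bil] diag pq qp algebra_simps)
  qed
  then show ?thesis
    using that[of "\<sigma> x ** x"] unfolding hermitian_squares_def by blast
qed

lemma Sym_sum_of_hermitian_squares:
  fixes b :: "'a::field^'n \<Rightarrow> 'a^'n \<Rightarrow> 'a"
  assumes two: "(2::'a) \<noteq> 0" and alt: "alternating_form b" and ns: "nonsingular_form b"
    and adj: "adjoint_to \<sigma> b" and a: "a \<in> Sym \<sigma>"
  shows "sum_of_hermitian_squares \<sigma> a"
proof -
  have bil: "bilinear_form b"
    using alt unfolding alternating_form_def by auto
  \<comment> \<open>The Gram matrix of the form \<open>b (a *v v) w\<close> in the standard
    basis.\<close>
  define k where "k i j = b (a *v axis i 1) (axis j 1)" for i j
  have k_skew: "k i j = - k j i" for i j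
  proof -
    have "k i j = b (axis i 1) (a *v axis j 1)"
      using adj a unfolding adjoint_to_def Sym_def k_def by simp
    then show ?thesis
      unfolding k_def
      by (simp add: alternating_form_skew[OF alt, of "axis i 1" "a *v axis j 1"])
  qed
  \<comment> \<open>The pairs \<open>(i, j)\<close> and \<open>(j, i)\<close> yield the same form,
    since both factors change sign; the factor 1/2 compensates for summing over all ordered
    pairs.\<close>
  have "\<exists>h. h \<in> hermitian_squares \<sigma> \<and>
      (\<forall>v w. b (h *v v) w = k i j / 2 * (v$i * w$j - v$j * w$i))" for i j
    by (rule hermitian_square_elementary_alternating[OF alt ns adj]) blast
  then obtain h where h: "\<And>i j. h i j \<in> hermitian_squares \<sigma>"
    "\<And>i j v w. b (h i j *v v) w = k i j / 2 * (v$i * w$j - v$j * w$i)"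
    by metis
  define s where "s = (\<Sum>(i,j)\<in>UNIV. h i j)"
  have "b (s *v v) w = b (a *v v) w" for v w
  proof -
    have hom: "module_hom scale_matrix (*s) (\<lambda>m. m *v v)"
      by unfold_locales
        (simp_all add: vec_eq_iff algebra_simps matrix_vector_mult_def sum.distrib sum_distrib_left)
    have "b (s *v v) w = (\<Sum>(i,j)\<in>UNIV. b (h i j *v v) w)"
      unfolding s_def
      by (simp add: module_hom.sum[OF hom] bilinear_form_sum_left[OF bil] case_prod_unfold)
    also have "\<dots> = (\<Sum>i\<in>UNIV. \<Sum>j\<in>UNIV. k i j / 2 * (v$i * w$j - v$j * w$i))"
      by (simp add: h(2) sum.cartesian_product)
    also have "\<dots> = (\<Sum>i\<in>UNIV. \<Sum>j\<in>UNIV. k i j / 2 * (v$i * w$j))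
        - (\<Sum>i\<in>UNIV. \<Sum>j\<in>UNIV. k i j / 2 * (v$j * w$i))"
      by (simp add: right_diff_distrib sum_subtractf)
    \<comment> \<open>Exchanging the names of the indices and using skewness of \<open>k\<close>
      makes the subtracted sum the negative of the first, so the two halves add up to
      \<open>k\<close>.\<close>
    also have "(\<Sum>i\<in>UNIV. \<Sum>j\<in>UNIV. k i j / 2 * (v$j * w$i))
        = (\<Sum>i\<in>UNIV. \<Sum>j\<in>UNIV. k j i / 2 * (v$i * w$j))"
      by (rule sum.swap)
    also have "\<dots> = (\<Sum>i\<in>UNIV. \<Sum>j\<in>UNIV. - (k i j / 2 * (v$i * w$j)))"
      by (intro sum.cong refl) (metis k_skew minus_divide_left mult_minus_left)
    also have "\<dots> = - (\<Sum>i\<in>UNIV. \<Sum>j\<in>UNIV. k i j / 2 * (v$i * w$j))"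
      by (simp add: sum_negf)
    also have "(\<Sum>i\<in>UNIV. \<Sum>j\<in>UNIV. k i j / 2 * (v$i * w$j)) - \<dots>
        = (\<Sum>i\<in>UNIV. \<Sum>j\<in>UNIV. v$i * w$j * k i j)"
      using two by (simp add: sum.distrib[symmetric] field_simps)
    also have "\<dots> = b (a *v v) w"
      unfolding k_def
      by (rule bilinear_form_expansion[OF bilinear_form_comp_matrix[OF bil], symmetric])
    finally show ?thesis .
  qed
  \<comment> \<open>The difference \<open>s *v v - a *v v\<close> is orthogonal to every
    \<open>w\<close>, so it vanishes by nonsingularity.\<close>
  then have "s *v v = a *v v" for v
    using ns unfolding nonsingular_form_def
    by (metis bilinear_form_diff_left[OF bil] right_minus_eq)
  then have "s = a"
    by (simp add: matrix_eq)
  moreover have "sum_of_hermitian_squares \<sigma> s"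
    unfolding s_def by (rule sum_of_hermitian_squares_sum) (auto simp: h(1))
  ultimately show ?thesis
    by simp
qed

theorem theorem4p7:
  fixes \<sigma> :: "'a::field^'n^'n \<Rightarrow> 'a^'n^'n"
    and m :: nat
  assumes "formally_real TYPE('a)"
    and "CARD('n) = 2 * m"
    and "symplectic \<sigma>"
  shows "PS_Conjecture \<sigma>"
  using assms(3) Sym_sum_of_hermitian_squares[OF formally_real_two_neq_0[OF assms(1)]]
  unfolding PS_Conjecture_def totally_sigma_positive_def symplectic_def by blast

end
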